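(* Let $X\subset\mathbb{R}$ be an interval and $(X,T,\mu)$ a probability preserving dynamical system which is exponentially 4-mixing for $BV$ against $L^\infty$, with the constant $C'$ uniformly bounded when $\psi_1,\psi_2,\varphi_1,\varphi_2$ are indicator functions of intervals. Let $(r_n)_n$ be a decreasing sequence of positive numbers such that $r_n\ge n^{-\beta}$ for some $\beta>0$ and, for some $\varepsilon>0$, \[ \int\mu(B(y,r_n))\,d\mu(y)\ge\frac{(\log n)^4(\log\log n)^{2+\varepsilon}}{n^2} \] for all large $n$. Then $\mu(\liminf_n F_{n,4r_n}^T)=1$.
   Context: $(X,T,\mu)$ is exponentially 4-mixing for $BV$ against $L^\infty$ if there is $\theta'>0$ such that for all $\psi_1,\psi_2$ of bounded variation, all $\varphi_1,\varphi_2\in L^\infty(\mu)$, and all integers $0\le a<b\le c$, $\bigl|\int\psi_1\cdot\psi_2\circ T^a\cdot\varphi_1\circ T^b\cdot\varphi_2\circ T^c\,d\mu-\int\psi_1\cdot\psi_2\circ T^a\,d\mu\int\varphi_1\cdot\varphi_2\circ T^{c-b}\,d\mu\bigr|\le C'(\psi_1,\psi_2,\varphi_1,\varphi_2)e^{-\theta'(b-a)}$ for some constant $C'(\psi_1,\psi_2,\varphi_1,\varphi_2)<\infty$. For $n\in\mathbb{N}$, $r>0$: $F_{n,r}^T:=\{x\in X: |T^ix-T^jx|<r \text{ for some } 0\le i<j<n\}$; $F_{n,4r_n}^T$ is this set with $r=4r_n$. $B(y,r)$ is the open ball of radius $r$ about $y$. *)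

theory Defs
  imports "HOL-Probability.Probability"
begin

definition bv_on :: "real set \<Rightarrow> (real \<Rightarrow> real) \<Rightarrow> bool" where
  "bv_on X f \<longleftrightarrow> (\<exists>B. \<forall>xs. sorted xs \<and> set xs \<subseteq> X \<longrightarrow>
      (\<Sum>i<length xs - 1. \<bar>f (xs ! Suc i) - f (xs ! i)\<bar>) \<le> B)"

definition Linf :: "'a measure \<Rightarrow> ('a \<Rightarrow> real) \<Rightarrow> bool" where
  "Linf M f \<longleftrightarrow> f \<in> borel_measurable M \<and> (\<exists>B. AE x in M. \<bar>f x\<bar> \<le> B)"

definition mix4_defect ::
  "real measure \<Rightarrow> (real \<Rightarrow> real) \<Rightarrow> (real \<Rightarrow> real) \<Rightarrow> (real \<Rightarrow> real) \<Rightarrow> (real \<Rightarrow> real)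
   \<Rightarrow> (real \<Rightarrow> real) \<Rightarrow> nat \<Rightarrow> nat \<Rightarrow> nat \<Rightarrow> real" where
  "mix4_defect M T \<psi>1 \<psi>2 \<phi>1 \<phi>2 a b c =
     \<bar>(\<integral>x. \<psi>1 x * \<psi>2 ((T ^^ a) x) * \<phi>1 ((T ^^ b) x) * \<phi>2 ((T ^^ c) x) \<partial>M)
      - (\<integral>x. \<psi>1 x * \<psi>2 ((T ^^ a) x) \<partial>M) * (\<integral>x. \<phi>1 x * \<phi>2 ((T ^^ (c - b)) x) \<partial>M)\<bar>"

definition exp_4mixing_BV_Linf_unif :: "real measure \<Rightarrow> (real \<Rightarrow> real) \<Rightarrow> bool" where
  "exp_4mixing_BV_Linf_unif M T \<longleftrightarrow> (\<exists>\<theta>>0.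
     (\<forall>\<psi>1 \<psi>2 \<phi>1 \<phi>2. bv_on (space M) \<psi>1 \<and> bv_on (space M) \<psi>2 \<and> Linf M \<phi>1 \<and> Linf M \<phi>2 \<longrightarrow>
        (\<exists>C. \<forall>a b c. a < b \<and> b \<le> c \<longrightarrow>
           mix4_defect M T \<psi>1 \<psi>2 \<phi>1 \<phi>2 a b c \<le> C * exp (- \<theta> * real (b - a)))) \<and>
     (\<exists>C0. \<forall>I1 I2 I3 I4 :: real set. is_interval I1 \<and> is_interval I2 \<and> is_interval I3 \<and> is_interval I4 \<longrightarrow>
        (\<forall>a b c. a < b \<and> b \<le> c \<longrightarrow>
           mix4_defect M T (indicator I1) (indicator I2) (indicator I3) (indicator I4) a b c
             \<le> C0 * exp (- \<theta> * real (b - a)))))"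

definition closeF :: "real set \<Rightarrow> (real \<Rightarrow> real) \<Rightarrow> nat \<Rightarrow> real \<Rightarrow> real set" where
  "closeF X T n r = {x \<in> X. \<exists>i j. i < j \<and> j < n \<and> \<bar>(T ^^ i) x - (T ^^ j) x\<bar> < r}"

end

theory Submission
  imports Defs "HOL-Real_Asymp.Real_Asymp"
begin

text \<open>
  Cut the line into intervals of length \<open>\<rho>\<close> and count the coincidences: triples of times
  \<open>i < m\<close> and \<open>2m \<le> j < 3m\<close> and an interval visited at both times. Keeping \<open>i\<close> and \<open>j\<close> in separate
  blocks makes the middle gap of any two such pairs at least \<open>m\<close>, so the second moment splits into
  products of two-point correlations \<open>\<mu>(T\<^sup>-\<^sup>i I \<inter> T\<^sup>-\<^sup>k J) \<mu>(T\<^sup>-\<^sup>j I \<inter> T\<^sup>-\<^sup>l J)\<close>. These are almost independent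
  unless two indices in a block are within \<open>g \<approx> log m\<close> of each other. With \<open>e = \<Sum> \<mu>(I)\<^sup>2\<close>, which is
  comparable to \<open>\<integral> \<mu>(B(y, \<rho>)) d\<mu>\<close>, Chebyshev's inequality bounds the probability of no
  coincidence by a constant times \<open>g / (m \<surd>e)\<close> up to a negligible error. For \<open>m = 2\<^sup>k\<close> this is
  \<open>O(1 / (k (log k)\<^sup>s))\<close> with \<open>s > 1\<close>, and Borel--Cantelli applies along \<open>n = 3 \<cdot> 2\<^sup>k\<close>; monotonicity in \<open>n\<close>
  and \<open>\<rho>\<close> covers the remaining \<open>n\<close>.
\<close>

section \<open>Invariance and mixing for visits to intervals\<close>

locale interval_mixing_system = prob_space M for M :: "real measure" +
  fixes T :: "real \<Rightarrow> real" and \<theta> C :: real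
  assumes borel_sets: "sets M = sets (restrict_space borel (space M))"
    and T_measurable: "T \<in> M \<rightarrow>\<^sub>M M"
    and T_invariant: "distr M M T = M"
    and rate_pos: "\<theta> > 0"
    and const_nonneg: "C \<ge> 0"
    and mixing: "\<lbrakk>is_interval I1; is_interval I2; is_interval I3; is_interval I4; a < b; b \<le> c\<rbrakk> \<Longrightarrow>
      mix4_defect M T (indicator I1) (indicator I2) (indicator I3) (indicator I4) a b c
        \<le> C * exp (- \<theta> * real (b - a))"
begin

lemma interval_sets: "is_interval I \<Longrightarrow> I \<inter> space M \<in> sets M"
  for I :: "real set"
  by (subst borel_sets) (auto simp: sets_restrict_space Int_commute intro: real_interval_borel_measurable)

lemma funpow_measurable: "(T ^^ k) \<in> M \<rightarrow>\<^sub>M M"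
  by (induction k) (use T_measurable in \<open>auto intro: measurable_comp\<close>)

lemma funpow_invariant: "distr M M (T ^^ k) = M"
proof (induction k)
  case (Suc k)
  have "distr M M (T ^^ Suc k) = distr (distr M M (T ^^ k)) M T"
    by (subst distr_distr) (auto simp: T_measurable funpow_measurable)
  then show ?case by (simp only: Suc T_invariant)
qed (simp add: id_def distr_id)

lemma expectation_funpow:
  fixes f :: "real \<Rightarrow> real"
  assumes "f \<in> borel_measurable M"
  shows "expectation (\<lambda>x. f ((T ^^ k) x)) = expectation f"
  using integral_distr[OF funpow_measurable assms, of k] funpow_invariant by simp

definition visit :: "nat \<Rightarrow> real set \<Rightarrow> real \<Rightarrow> real"
  where "visit k I x = indicator I ((T ^^ k) x)"

definition corr :: "nat \<Rightarrow> nat \<Rightarrow> real set \<Rightarrow> real set \<Rightarrow> real"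
  where "corr i k I J = expectation (\<lambda>x. visit i I x * visit k J x)"

text \<open>Intervals are subsets of the whole line, so that \<open>UNIV\<close> and grid cells can
  be used as they are; the intersection with \<open>space M\<close> makes them events.\<close>

definition mass :: "real set \<Rightarrow> real"
  where "mass I = prob (I \<inter> space M)"

lemma visit_nonneg: "0 \<le> visit k I x" and visit_le_1: "visit k I x \<le> 1"
  by (auto simp: visit_def indicator_def)

lemma visit_measurable: "is_interval I \<Longrightarrow> visit k I \<in> borel_measurable M"
proof -
  assume I: "is_interval I"
  have "(indicator I :: real \<Rightarrow> real) \<in> borel_measurable M"
    using borel_measurable_indicator[OF interval_sets[OF I]]
    by (rule measurable_cong[THEN iffD1, rotated]) (auto simp: indicator_def)
  from measurable_compose[OF funpow_measurable this] show ?thesis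
    unfolding visit_def .
qed

lemma visit_add: "visit (i + k) I x = visit k I ((T ^^ i) x)"
  by (simp add: visit_def funpow_add add.commute[of i k])

lemma integrable_unit:
  fixes f :: "real \<Rightarrow> real"
  assumes "f \<in> borel_measurable M" "\<And>x. 0 \<le> f x" "\<And>x. f x \<le> 1"
  shows "integrable M f"
  using assms by (intro integrable_const_bound[of _ 1]) auto

lemma visit_integrable: "is_interval I \<Longrightarrow> integrable M (visit k I)"
  by (intro integrable_unit visit_measurable visit_nonneg visit_le_1)

lemma visit2_integrable:
  "is_interval I \<Longrightarrow> is_interval J \<Longrightarrow> integrable M (\<lambda>x. visit i I x * visit k J x)"
  by (intro integrable_unit borel_measurable_times visit_measurable mult_nonneg_nonneg
      visit_nonneg mult_le_one visit_le_1) auto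

lemma visit4_integrable:
  assumes "is_interval I" "is_interval J" "is_interval I'" "is_interval J'"
  shows "integrable M (\<lambda>x. (visit i I x * visit k J x) * (visit j I' x * visit l J' x))"
  using assms
  by (intro integrable_unit borel_measurable_times visit_measurable mult_nonneg_nonneg
      visit_nonneg mult_le_one visit_le_1) auto

lemma expectation_visit:
  assumes "is_interval I"
  shows "expectation (visit k I) = mass I"
proof -
  have "expectation (visit k I) = expectation (\<lambda>x. visit 0 I ((T ^^ k) x))"
    using visit_add[of k 0 I] by (intro Bochner_Integration.integral_cong) simp_all
  also have "\<dots> = expectation (visit 0 I)"
    by (intro expectation_funpow visit_measurable assms)
  also have "\<dots> = mass I"
    by (simp add: visit_def[abs_def] mass_def)
  finally show ?thesis .
qed

lemma corr_commute: "corr i k I J = corr k i J I"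
  by (simp add: corr_def mult.commute)

lemma corr_nonneg: "0 \<le> corr i k I J"
  by (simp add: corr_def visit_nonneg)

lemma corr_UNIV: "is_interval I \<Longrightarrow> corr i k I UNIV = mass I"
  using expectation_visit[of I i] by (simp add: corr_def visit_def[of _ UNIV])

lemma corr_funpow:
  assumes "is_interval I" "is_interval J"
  shows "corr (i + a) (i + b) I J = corr a b I J"
  unfolding corr_def visit_add
  by (rule expectation_funpow[of "\<lambda>x. visit a I x * visit b J x"])
    (intro borel_measurable_times visit_measurable assms)

text \<open>Invariance shifts all times back by \<open>i\<close>, so that the first visit happens at
  time 0 as in \<open>mix4_defect\<close>. The middle gap is then at least \<open>g\<close>, and
  \<open>C \<ge> 0\<close> allows the exponential to be weakened to \<open>g\<close>.\<close>

lemma four_visits_ordered: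
  assumes int: "is_interval I" "is_interval J" "is_interval I'" "is_interval J'"
    and ord: "i \<le> k" "k + g \<le> j" "j \<le> l" "0 < g"
  shows "\<bar>expectation (\<lambda>x. (visit i I x * visit k J x) * (visit j I' x * visit l J' x))
      - corr i k I J * corr j l I' J'\<bar> \<le> C * exp (- \<theta> * real g)"
proof -
  obtain a b c where abc: "k = i + a" "j = i + b" "l = i + c"
    using ord by (metis le_Suc_ex le_trans le_add1)
  define h where "h x = (visit 0 I x * visit a J x) * (visit b I' x * visit c J' x)" for x
  have "h \<in> borel_measurable M"
    unfolding h_def by (intro borel_measurable_times visit_measurable int)
  from expectation_funpow[OF this, of i]
  have "expectation (\<lambda>x. (visit i I x * visit k J x) * (visit j I' x * visit l J' x)) = expectation h"
    by (simp add: abc h_def visit_add visit_add[of i 0, simplified])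
  moreover have "corr i k I J = corr 0 a I J"
    using corr_funpow[OF int(1,2), of i 0 a] abc by simp
  moreover have "corr j l I' J' = corr 0 (c - b) I' J'"
    using corr_funpow[OF int(3,4), of j 0 "c - b"] abc ord by simp
  ultimately have "\<bar>expectation (\<lambda>x. (visit i I x * visit k J x) * (visit j I' x * visit l J' x))
      - corr i k I J * corr j l I' J'\<bar>
    = mix4_defect M T (indicator I) (indicator J) (indicator I') (indicator J') a b c"
    by (simp add: mix4_defect_def h_def[abs_def] corr_def visit_def mult.assoc)
  also have "\<dots> \<le> C * exp (- \<theta> * real (b - a))"
    using ord abc by (intro mixing int) auto
  also have "\<dots> \<le> C * exp (- \<theta> * real g)"
    using ord abc rate_pos const_nonneg by (intro mult_left_mono) auto
  finally show ?thesis .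
qed

text \<open>In the second moment the early times \<open>i\<close>, \<open>k\<close> and the late
  times \<open>j\<close>, \<open>l\<close> come in no particular order. The factors commute, so a
  swap within each block reduces every case to the ordered one.\<close>

lemma four_visits:
  assumes int: "is_interval I" "is_interval J" "is_interval I'" "is_interval J'"
    and ord: "i \<le> s" "k \<le> s" "s + g \<le> j" "s + g \<le> l" "0 < g"
  shows "\<bar>expectation (\<lambda>x. (visit i I x * visit k J x) * (visit j I' x * visit l J' x))
      - corr i k I J * corr j l I' J'\<bar> \<le> C * exp (- \<theta> * real g)"
proof -
  consider "i \<le> k" "j \<le> l" | "i \<le> k" "l \<le> j" | "k \<le> i" "j \<le> l" | "k \<le> i" "l \<le> j"
    by linarith
  then show ?thesis
  proof cases
    case 1
    then show ?thesis using four_visits_ordered[of I J I' J' i k g j l] int ord by simp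
  next
    case 2
    then show ?thesis using four_visits_ordered[of I J J' I' i k g l j] int ord
      by (simp add: corr_commute[of l j] mult.commute[of "visit l J' _"])
  next
    case 3
    then show ?thesis using four_visits_ordered[of J I I' J' k i g j l] int ord
      by (simp add: corr_commute[of k i] mult.commute[of "visit k J _"])
  next
    case 4
    then show ?thesis using four_visits_ordered[of J I J' I' k i g l j] int ord
      by (simp add: corr_commute[of k i] corr_commute[of l j]
          mult.commute[of "visit k J _"] mult.commute[of "visit l J' _"])
  qed
qed

text \<open>The whole line is an interval that is visited at all times. With it in the second and
  fourth slots, the bound for four visits becomes one for two.\<close>

lemma corr_far:
  assumes int: "is_interval I" "is_interval J" and far: "i + g \<le> k \<or> k + g \<le> i" "0 < g"
  shows "\<bar>corr i k I J - mass I * mass J\<bar> \<le> C * exp (- \<theta> * real g)"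
  using far(1)
proof
  assume "i + g \<le> k"
  then show ?thesis
    using four_visits[of I UNIV J UNIV i i i g k k] int far(2)
    by (simp add: corr_UNIV is_interval_univ) (simp add: corr_def visit_def)
next
  assume "k + g \<le> i"
  then show ?thesis
    using four_visits[of J UNIV I UNIV k k k g i i] int far(2)
    by (simp add: corr_UNIV is_interval_univ) (simp add: corr_def visit_def mult.commute)
qed

end

section \<open>First and second moments of the coincidence count\<close>

lemma card_close_pairs:
  fixes s m g :: nat
  shows "(\<Sum>i\<in>{s..<s+m}. \<Sum>k\<in>{s..<s+m}. of_bool (\<not> (i + g \<le> k \<or> k + g \<le> i)) :: real)
    \<le> 2 * real g * real m"
proof -
  have "(\<Sum>k\<in>{s..<s+m}. of_bool (\<not> (i + g \<le> k \<or> k + g \<le> i)) :: real) \<le> 2 * real g" for i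
  proof -
    have "(\<Sum>k\<in>{s..<s+m}. of_bool (\<not> (i + g \<le> k \<or> k + g \<le> i)) :: real)
        = real (card {k \<in> {s..<s+m}. \<not> (i + g \<le> k \<or> k + g \<le> i)})"
      by (simp add: Int_def)
    \<comment> \<open>For fixed \<open>i\<close> the close \<open>k\<close> lie in a window of
      length at most \<open>2 * g\<close>; truncated subtraction can only shorten it.\<close>
    also have "card {k \<in> {s..<s+m}. \<not> (i + g \<le> k \<or> k + g \<le> i)} \<le> card {i - g..<i + g}"
      by (intro card_mono) auto
    also have "card {i - g..<i + g} \<le> 2 * g" by simp
    finally show ?thesis by simp
  qed
  then have "(\<Sum>i\<in>{s..<s+m}. \<Sum>k\<in>{s..<s+m}. of_bool (\<not> (i + g \<le> k \<or> k + g \<le> i)) :: real)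
      \<le> (\<Sum>i\<in>{s..<s+m}. 2 * real g)"
    by (intro sum_mono)
  then show ?thesis by (simp add: mult.commute)
qed

context interval_mixing_system
begin

text \<open>For disjoint intervals this is the probability that two independent points with law
  \<open>M\<close> fall into the same one.\<close>

definition energy :: "'i set \<Rightarrow> ('i \<Rightarrow> real set) \<Rightarrow> real"
  where "energy Z I = (\<Sum>a\<in>Z. (mass (I a))\<^sup>2)"

definition coincidences :: "'i set \<Rightarrow> ('i \<Rightarrow> real set) \<Rightarrow> nat \<Rightarrow> real \<Rightarrow> real"
  where "coincidences Z I m x =
    (\<Sum>(i, j, a)\<in>{0..<m} \<times> {2*m..<3*m} \<times> Z. visit i (I a) x * visit j (I a) x)"

lemma mass_nonneg: "0 \<le> mass I"
  by (simp add: mass_def)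

context
  fixes Z :: "'i set" and I :: "'i \<Rightarrow> real set"
  assumes Z_finite: "finite Z" and I_interval: "\<And>a. a \<in> Z \<Longrightarrow> is_interval (I a)"
    and I_disjoint: "disjoint_family_on I Z"
begin

lemma sum_visit_le_1: "(\<Sum>a\<in>Z. visit k (I a) x) \<le> 1"
proof -
  have "(\<Sum>a\<in>Z. visit k (I a) x) = indicator (\<Union>a\<in>Z. I a) ((T ^^ k) x)"
    unfolding visit_def using Z_finite I_disjoint by (simp add: indicator_UN_disjoint)
  then show ?thesis by (simp add: indicator_def)
qed

text \<open>At any time a point lies in at most one of the disjoint intervals, so summing out one
  index of a correlation leaves at most the mass at the other. No mixing enters, hence the bound
  also serves for close times.\<close>

lemma sum_corr_right_le:
  assumes "is_interval J"
  shows "(\<Sum>b\<in>Z. corr i k J (I b)) \<le> mass J"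
proof -
  have "(\<Sum>b\<in>Z. corr i k J (I b)) = expectation (\<lambda>x. \<Sum>b\<in>Z. visit i J x * visit k (I b) x)"
    unfolding corr_def
    by (subst Bochner_Integration.integral_sum) (auto intro!: visit2_integrable assms I_interval)
  also have "\<dots> \<le> expectation (visit i J)"
  proof (rule integral_mono)
    show "integrable M (\<lambda>x. \<Sum>b\<in>Z. visit i J x * visit k (I b) x)"
      by (intro Bochner_Integration.integrable_sum visit2_integrable assms I_interval)
    show "(\<Sum>b\<in>Z. visit i J x * visit k (I b) x) \<le> visit i J x" for x
      using mult_left_mono[OF sum_visit_le_1 visit_nonneg]
      by (simp flip: sum_distrib_left)
  qed (rule visit_integrable[OF assms])
  finally show ?thesis using expectation_visit[OF assms] by simp
qed

lemma sum_corr_left_le: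
  assumes "is_interval J"
  shows "(\<Sum>a\<in>Z. corr i k (I a) J) \<le> mass J"
  using sum_corr_right_le[OF assms, of k i] by (simp add: corr_commute[of i k])

lemma sum_mass_le_1: "(\<Sum>a\<in>Z. mass (I a)) \<le> 1"
proof -
  have "(\<Sum>a\<in>Z. mass (I a)) = (\<Sum>a\<in>Z. corr 0 0 (I a) UNIV)"
    by (intro sum.cong) (auto simp: corr_UNIV I_interval)
  also have "\<dots> \<le> mass UNIV" by (intro sum_corr_left_le) auto
  finally show ?thesis by (simp add: mass_def prob_space)
qed

lemma sum_corr_le_1: "(\<Sum>a\<in>Z. \<Sum>b\<in>Z. corr i k (I a) (I b)) \<le> 1"
proof -
  have "(\<Sum>a\<in>Z. \<Sum>b\<in>Z. corr i k (I a) (I b)) \<le> (\<Sum>a\<in>Z. mass (I a))"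
    by (intro sum_mono sum_corr_right_le I_interval)
  then show ?thesis using sum_mass_le_1 by simp
qed

lemma energy_nonneg: "0 \<le> energy Z I"
  by (simp add: energy_def sum_nonneg)

lemma energy_le_1: "energy Z I \<le> 1"
proof -
  have "energy Z I \<le> (\<Sum>a\<in>Z. mass (I a))"
    unfolding energy_def
    by (intro sum_mono) (simp add: power2_eq_square mult_left_le mass_def)
  then show ?thesis using sum_mass_le_1 by simp
qed

lemma mass_le_sqrt_energy: "a \<in> Z \<Longrightarrow> mass (I a) \<le> sqrt (energy Z I)"
  unfolding energy_def
  using member_le_sum[of a Z "\<lambda>a. (mass (I a))\<^sup>2"] Z_finite
  by (intro real_le_rsqrt) auto

text \<open>One factor of each cube is at most \<open>sqrt (energy Z I)\<close>, because its square
  is a term of the energy.\<close>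

lemma sum_cube_mass_le: "(\<Sum>a\<in>Z. mass (I a) ^ 3) \<le> energy Z I * sqrt (energy Z I)"
proof -
  have "(\<Sum>a\<in>Z. mass (I a) ^ 3) \<le> (\<Sum>a\<in>Z. (mass (I a))\<^sup>2 * sqrt (energy Z I))"
    using mass_le_sqrt_energy
    by (intro sum_mono) (auto simp: power3_eq_cube power2_eq_square intro!: mult_left_mono mass_nonneg)
  then show ?thesis by (simp add: energy_def sum_distrib_right)
qed

text \<open>The inequality between geometric and arithmetic mean splits the product of masses into
  squares that depend on one index each. The other index is then summed out of the correlation,
  which leaves cubes of masses.\<close>

lemma sum_corr_mass_le:
  "(\<Sum>a\<in>Z. \<Sum>b\<in>Z. corr i k (I a) (I b) * (mass (I a) * mass (I b))) \<le> energy Z I * sqrt (energy Z I)"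
proof -
  let ?p = "\<lambda>a b. corr i k (I a) (I b)"
  have "(\<Sum>a\<in>Z. \<Sum>b\<in>Z. ?p a b * (mass (I a) * mass (I b)))
      \<le> (\<Sum>a\<in>Z. \<Sum>b\<in>Z. ?p a b * ((mass (I a))\<^sup>2 / 2 + (mass (I b))\<^sup>2 / 2))"
  proof (intro sum_mono mult_left_mono corr_nonneg)
    fix a b
    show "mass (I a) * mass (I b) \<le> (mass (I a))\<^sup>2 / 2 + (mass (I b))\<^sup>2 / 2"
      using sum_squares_bound[of "mass (I a)" "mass (I b)"] by simp
  qed
  also have "\<dots> = (\<Sum>a\<in>Z. (\<Sum>b\<in>Z. ?p a b) * ((mass (I a))\<^sup>2 / 2))
      + (\<Sum>b\<in>Z. (\<Sum>a\<in>Z. ?p a b) * ((mass (I b))\<^sup>2 / 2))"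
    by (simp add: distrib_left sum.distrib sum_distrib_right sum_divide_distrib)
      (rule sum.swap)
  also have "\<dots> \<le> (\<Sum>a\<in>Z. mass (I a) * ((mass (I a))\<^sup>2 / 2))
      + (\<Sum>b\<in>Z. mass (I b) * ((mass (I b))\<^sup>2 / 2))"
    by (intro add_mono sum_mono mult_right_mono sum_corr_right_le sum_corr_left_le I_interval) auto
  also have "\<dots> = (\<Sum>a\<in>Z. mass (I a) ^ 3)"
    by (simp add: power3_eq_cube power2_eq_square mult.assoc flip: sum.distrib)
  finally show ?thesis using sum_cube_mass_le by simp
qed

text \<open>At far times a correlation is a product of masses up to \<open>D\<close>. With
  \<open>e\<close> for the energy, replacing both correlations gives \<open>e^2\<close>, replacing
  one gives \<open>e^(3/2)\<close>, replacing none gives \<open>e\<close>. The flags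
  \<open>near\<close> merge the four cases into one expression that can be summed over the
  times.\<close>

lemma sum_corr_corr_le:
  assumes g: "0 < g"
  defines "D \<equiv> C * exp (- \<theta> * real g)"
    and "near \<equiv> \<lambda>i k. of_bool (\<not> (i + g \<le> k \<or> k + g \<le> i)) :: real"
  shows "(\<Sum>a\<in>Z. \<Sum>b\<in>Z. corr i k (I a) (I b) * corr j l (I a) (I b))
    \<le> 2 * D + (energy Z I)\<^sup>2 + (near i k + near j l) * (energy Z I * sqrt (energy Z I)) + near i k * near j l * energy Z I"
proof -
  let ?p = "\<lambda>a b. corr i k (I a) (I b)" and ?q = "\<lambda>a b. corr j l (I a) (I b)"
  let ?m = "\<lambda>a b. mass (I a) * mass (I b)"
  have D: "0 \<le> D" by (simp add: D_def const_nonneg)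
  have E: "0 \<le> energy Z I" "0 \<le> energy Z I * sqrt (energy Z I)" using energy_nonneg by auto
  have far: "corr i k (I a) (I b) \<le> ?m a b + D"
    if "i + g \<le> k \<or> k + g \<le> i" "a \<in> Z" "b \<in> Z" for i k a b
    using corr_far[of "I a" "I b" i g k] that g I_interval by (auto simp: D_def abs_le_iff)
  \<comment> \<open>The error \<open>D\<close> is weighted by correlations whose sum over all pairs
    of intervals is at most 1, so \<open>card Z\<close> does not appear.\<close>
  have split: "(\<Sum>a\<in>Z. \<Sum>b\<in>Z. corr j l (I a) (I b) * corr i k (I a) (I b))
      \<le> (\<Sum>a\<in>Z. \<Sum>b\<in>Z. corr j l (I a) (I b) * ?m a b) + D"
    if "i + g \<le> k \<or> k + g \<le> i" for i k j l
  proof -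
    have "(\<Sum>a\<in>Z. \<Sum>b\<in>Z. corr j l (I a) (I b) * corr i k (I a) (I b))
        \<le> (\<Sum>a\<in>Z. \<Sum>b\<in>Z. corr j l (I a) (I b) * (?m a b + D))"
      by (intro sum_mono mult_left_mono corr_nonneg far that)
    also have "\<dots> = (\<Sum>a\<in>Z. \<Sum>b\<in>Z. corr j l (I a) (I b) * ?m a b)
        + (\<Sum>a\<in>Z. \<Sum>b\<in>Z. corr j l (I a) (I b)) * D"
      by (simp add: distrib_left sum.distrib sum_distrib_right)
    also have "(\<Sum>a\<in>Z. \<Sum>b\<in>Z. corr j l (I a) (I b)) * D \<le> 1 * D"
      by (intro mult_right_mono sum_corr_le_1 D)
    finally show ?thesis by simp
  qed
  consider "near i k = 1" "near j l = 1"
    | "near i k = 0" "near j l = 0" "i + g \<le> k \<or> k + g \<le> i" "j + g \<le> l \<or> l + g \<le> j"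
    | "near i k = 0" "near j l = 1" "i + g \<le> k \<or> k + g \<le> i"
    | "near i k = 1" "near j l = 0" "j + g \<le> l \<or> l + g \<le> j"
    by (auto simp: near_def)
  then show ?thesis
  proof cases
    case 1
    \<comment> \<open>Neither pair is far: \<open>?q a b\<close> is a single term of a sum bounded
      by \<open>mass (I a)\<close>, and summing \<open>?p a b\<close> over \<open>b\<close> gives
      the second factor \<open>mass (I a)\<close>.\<close>
    have "(\<Sum>a\<in>Z. \<Sum>b\<in>Z. ?p a b * ?q a b) \<le> (\<Sum>a\<in>Z. \<Sum>b\<in>Z. ?p a b * mass (I a))"
    proof (intro sum_mono mult_left_mono corr_nonneg)
      fix a b assume "a \<in> Z" "b \<in> Z"
      then show "?q a b \<le> mass (I a)"
        using sum_corr_right_le[of "I a" j l] I_interval Z_finite corr_nonneg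
          member_le_sum[of b Z "\<lambda>b. ?q a b"] by fastforce
    qed
    also have "\<dots> = (\<Sum>a\<in>Z. (\<Sum>b\<in>Z. ?p a b) * mass (I a))"
      by (simp add: sum_distrib_right)
    also have "\<dots> \<le> (\<Sum>a\<in>Z. mass (I a) * mass (I a))"
      by (intro sum_mono mult_right_mono sum_corr_right_le I_interval mass_nonneg)
    also have "\<dots> = energy Z I" by (simp add: energy_def power2_eq_square)
    finally show ?thesis
      using D E zero_le_power2[of "energy Z I"] unfolding 1 one_add_one mult_1 by linarith
  next
    case 2
    have "(\<Sum>a\<in>Z. \<Sum>b\<in>Z. ?p a b * ?q a b) \<le> (\<Sum>a\<in>Z. \<Sum>b\<in>Z. ?p a b * ?m a b) + D"
      by (rule split[OF 2(4)])
    \<comment> \<open>The weights \<open>?m a b\<close> also sum to at most 1, so the second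
      replacement costs only another \<open>D\<close>.\<close>
    also have "(\<Sum>a\<in>Z. \<Sum>b\<in>Z. ?p a b * ?m a b) \<le> (\<Sum>a\<in>Z. \<Sum>b\<in>Z. (?m a b + D) * ?m a b)"
      by (intro sum_mono mult_right_mono far 2(3) mult_nonneg_nonneg mass_nonneg)
    also have "\<dots> = (\<Sum>a\<in>Z. \<Sum>b\<in>Z. (mass (I a))\<^sup>2 * (mass (I b))\<^sup>2) + (\<Sum>a\<in>Z. \<Sum>b\<in>Z. ?m a b) * D"
      by (simp add: algebra_simps sum.distrib sum_distrib_left power2_eq_square)
    also have "(\<Sum>a\<in>Z. \<Sum>b\<in>Z. ?m a b) = (\<Sum>a\<in>Z. mass (I a)) * (\<Sum>a\<in>Z. mass (I a))"
      by (simp add: sum_product)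
    also have "\<dots> \<le> 1"
      by (intro mult_le_one sum_mass_le_1 sum_nonneg mass_nonneg)
    also have "(\<Sum>a\<in>Z. \<Sum>b\<in>Z. (mass (I a))\<^sup>2 * (mass (I b))\<^sup>2) = (energy Z I)\<^sup>2"
      by (simp add: energy_def power2_eq_square[of "sum _ _"] sum_product)
    finally show ?thesis using 2 D by (simp add: mult_right_mono)
  next
    case 3
    have "(\<Sum>a\<in>Z. \<Sum>b\<in>Z. ?p a b * ?q a b) \<le> energy Z I * sqrt (energy Z I) + D"
      using split[OF 3(3), of j l] sum_corr_mass_le[of j l]
      by (simp add: mult.commute[of "corr j l _ _"])
    then show ?thesis
      using D zero_le_power2[of "energy Z I"] unfolding 3 add_0 mult_1 mult_zero_left add_0_right
      by linarith
  next
    case 4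
    have "(\<Sum>a\<in>Z. \<Sum>b\<in>Z. ?p a b * ?q a b) \<le> energy Z I * sqrt (energy Z I) + D"
      using split[OF 4(3), of i k] sum_corr_mass_le[of i k] by simp
    then show ?thesis
      using D zero_le_power2[of "energy Z I"]
      unfolding 4 add_0 mult_1 mult_zero_left mult_zero_right add_0_right
      by linarith
  qed
qed

lemma coincidences_measurable: "coincidences Z I m \<in> borel_measurable M"
  unfolding coincidences_def[abs_def] case_prod_beta
  by (intro borel_measurable_sum borel_measurable_times visit_measurable I_interval) auto

text \<open>Times from the two blocks are more than \<open>m\<close> apart, hence far, and each of
  the \<open>m^2\<close> pairs of times contributes the energy up to an error \<open>D\<close> per
  interval.\<close>

lemma coincidences_expectation_ge:
  assumes g: "0 < g" "g \<le> m"
  defines "D \<equiv> C * exp (- \<theta> * real g)"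
  shows "(real m)\<^sup>2 * (energy Z I - real (card Z) * D) \<le> expectation (coincidences Z I m)"
proof -
  let ?P = "{0..<m} \<times> {2*m..<3*m} \<times> Z"
  have "(real m)\<^sup>2 * (energy Z I - real (card Z) * D)
      = (\<Sum>i\<in>{0..<m}. \<Sum>j\<in>{2*m..<3*m}. \<Sum>a\<in>Z. (mass (I a))\<^sup>2 - D)"
    by (simp add: energy_def sum_subtractf power2_eq_square[of "real m"])
  also have "\<dots> \<le> (\<Sum>i\<in>{0..<m}. \<Sum>j\<in>{2*m..<3*m}. \<Sum>a\<in>Z. corr i j (I a) (I a))"
  proof (intro sum_mono)
    fix i j a assume "i \<in> {0..<m}" "j \<in> {2*m..<3*m}" "a \<in> Z"
    then show "(mass (I a))\<^sup>2 - D \<le> corr i j (I a) (I a)"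
      using corr_far[of "I a" "I a" i g j] g I_interval
      by (auto simp: D_def abs_le_iff power2_eq_square)
  qed
  also have "\<dots> = (\<Sum>(i, j, a)\<in>?P. corr i j (I a) (I a))"
    by (simp add: sum.cartesian_product)
  also have "\<dots> = expectation (coincidences Z I m)"
    unfolding coincidences_def[abs_def] corr_def case_prod_beta
    by (subst Bochner_Integration.integral_sum) (auto intro!: visit2_integrable I_interval)
  finally show ?thesis .
qed

text \<open>Expanding the square gives \<open>m^4\<close> quadruples of times and
  \<open>(card Z)^2\<close> pairs of intervals, each decoupled at cost \<open>D\<close>. Each block
  has at most \<open>2 * g * m\<close> close pairs: one close pair accounts for the term with
  \<open>e * sqrt e\<close>, two for the term with \<open>e\<close>.\<close>

lemma coincidences_second_moment_le:
  assumes g: "0 < g" "g \<le> m"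
  defines "D \<equiv> C * exp (- \<theta> * real g)" and "e \<equiv> energy Z I"
  shows "expectation (\<lambda>x. (coincidences Z I m x)\<^sup>2)
    \<le> real m ^ 4 * (e\<^sup>2 + 2 * D + (real (card Z))\<^sup>2 * D)
      + 4 * real g * real m ^ 3 * (e * sqrt e) + 4 * (real g)\<^sup>2 * (real m)\<^sup>2 * e"
proof -
  let ?A = "{0..<m}" and ?B = "{2*m..<3*m}"
  let ?P = "?A \<times> ?B \<times> Z"
  define near where "near i k = (of_bool (\<not> (i + g \<le> k \<or> k + g \<le> i)) :: real)" for i k
  define w where "w = (\<lambda>(i, j, a) x. visit i (I a) x * visit j (I a) x)"
  have triple: "(\<Sum>(i, j, a)\<in>?P. f i j a) = (\<Sum>i\<in>?A. \<Sum>j\<in>?B. \<Sum>a\<in>Z. f i j a)"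
    for f :: "nat \<Rightarrow> nat \<Rightarrow> 'i \<Rightarrow> real"
    by (simp add: sum.cartesian_product)
  note E = energy_nonneg[folded e_def]
  have int: "integrable M (\<lambda>x. w p x * w q x)" if "p \<in> ?P" "q \<in> ?P" for p q
    using that unfolding w_def by (auto intro!: visit4_integrable I_interval)
  have sq: "(coincidences Z I m x)\<^sup>2 = (\<Sum>p\<in>?P. \<Sum>q\<in>?P. w p x * w q x)" for x
    unfolding coincidences_def w_def power2_eq_square sum_product
    by (intro sum.cong) auto
  have "expectation (\<lambda>x. (coincidences Z I m x)\<^sup>2) = (\<Sum>p\<in>?P. \<Sum>q\<in>?P. expectation (\<lambda>x. w p x * w q x))"
    unfolding sq
    by (simp add: Bochner_Integration.integral_sum Bochner_Integration.integrable_sum int)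
  also have "\<dots> \<le> (\<Sum>(i, j, a)\<in>?P. \<Sum>(k, l, b)\<in>?P. corr i k (I a) (I b) * corr j l (I a) (I b) + D)"
  proof (intro sum_mono, clarify, intro sum_mono, clarify)
    fix i j a k l b
    assume A: "i \<in> ?A" "j \<in> ?B" "a \<in> Z" "k \<in> ?A" "l \<in> ?B" "b \<in> Z"
    have "expectation (\<lambda>x. w (i, j, a) x * w (k, l, b) x)
      = expectation (\<lambda>x. (visit i (I a) x * visit k (I b) x) * (visit j (I a) x * visit l (I b) x))"
      by (simp add: w_def mult_ac)
    also have "\<dots> \<le> corr i k (I a) (I b) * corr j l (I a) (I b) + D"
      \<comment> \<open>The separating time is \<open>s = m\<close>: early times are below
        \<open>m\<close>, late ones are at least \<open>2 * m\<close>, hence at least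
        \<open>m + g\<close>.\<close>
      using four_visits[of "I a" "I b" "I a" "I b" i m k g j l] A g I_interval
      by (auto simp: D_def abs_le_iff)
    finally show "expectation (\<lambda>x. w (i, j, a) x * w (k, l, b) x)
      \<le> corr i k (I a) (I b) * corr j l (I a) (I b) + D" .
  qed
  also have "\<dots> = (\<Sum>(i, j, a)\<in>?P. \<Sum>(k, l, b)\<in>?P. corr i k (I a) (I b) * corr j l (I a) (I b))
      + real m ^ 4 * ((real (card Z))\<^sup>2 * D)"
    by (simp add: case_prod_beta sum.distrib card_cartesian_product power2_eq_square power4_eq_xxxx)
  also have "(\<Sum>(i, j, a)\<in>?P. \<Sum>(k, l, b)\<in>?P. corr i k (I a) (I b) * corr j l (I a) (I b))
      = (\<Sum>i\<in>?A. \<Sum>j\<in>?B. \<Sum>a\<in>Z. \<Sum>k\<in>?A. \<Sum>l\<in>?B. \<Sum>b\<in>Z. corr i k (I a) (I b) * corr j l (I a) (I b))"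
    by (simp only: triple)
  \<comment> \<open>The sums over intervals move innermost, since \<open>sum_corr_corr_le\<close>
    applies at fixed times.\<close>
  also have "\<dots> = (\<Sum>i\<in>?A. \<Sum>k\<in>?A. \<Sum>j\<in>?B. \<Sum>l\<in>?B. \<Sum>a\<in>Z. \<Sum>b\<in>Z. corr i k (I a) (I b) * corr j l (I a) (I b))"
  proof (rule sum.cong[OF refl])
    fix i
    have "(\<Sum>j\<in>?B. \<Sum>a\<in>Z. \<Sum>k\<in>?A. \<Sum>l\<in>?B. \<Sum>b\<in>Z. corr i k (I a) (I b) * corr j l (I a) (I b))
      = (\<Sum>j\<in>?B. \<Sum>k\<in>?A. \<Sum>l\<in>?B. \<Sum>a\<in>Z. \<Sum>b\<in>Z. corr i k (I a) (I b) * corr j l (I a) (I b))"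
      by (subst sum.swap[of _ ?A Z], subst sum.swap[of _ ?B Z]) (rule refl)
    also have "\<dots> = (\<Sum>k\<in>?A. \<Sum>j\<in>?B. \<Sum>l\<in>?B. \<Sum>a\<in>Z. \<Sum>b\<in>Z. corr i k (I a) (I b) * corr j l (I a) (I b))"
      by (rule sum.swap)
    finally show "(\<Sum>j\<in>?B. \<Sum>a\<in>Z. \<Sum>k\<in>?A. \<Sum>l\<in>?B. \<Sum>b\<in>Z. corr i k (I a) (I b) * corr j l (I a) (I b))
      = (\<Sum>k\<in>?A. \<Sum>j\<in>?B. \<Sum>l\<in>?B. \<Sum>a\<in>Z. \<Sum>b\<in>Z. corr i k (I a) (I b) * corr j l (I a) (I b))" .
  qed
  also have "\<dots> \<le> (\<Sum>i\<in>?A. \<Sum>k\<in>?A. \<Sum>j\<in>?B. \<Sum>l\<in>?B.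
      2 * D + e\<^sup>2 + (near i k + near j l) * (e * sqrt e) + near i k * near j l * e)"
    unfolding D_def e_def near_def
    by (intro sum_mono sum_corr_corr_le[OF g(1)])
  also have "\<dots> = real m ^ 4 * (2 * D + e\<^sup>2)
      + (real m)\<^sup>2 * ((\<Sum>i\<in>?A. \<Sum>k\<in>?A. near i k) + (\<Sum>j\<in>?B. \<Sum>l\<in>?B. near j l)) * (e * sqrt e)
      + (\<Sum>i\<in>?A. \<Sum>k\<in>?A. near i k) * (\<Sum>j\<in>?B. \<Sum>l\<in>?B. near j l) * e"
    (is "_ = _ + _ * (?NA + ?NB) * _ + _")
  proof -
    \<comment> \<open>Here \<open>x\<close> stands for \<open>near i k\<close>, which is constant in
      the late times.\<close>
    have 1: "(\<Sum>j\<in>?B. \<Sum>l\<in>?B. 2 * D + e\<^sup>2 + (x + near j l) * (e * sqrt e) + x * near j l * e)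
      = (real m)\<^sup>2 * (2 * D + e\<^sup>2 + x * (e * sqrt e)) + (\<Sum>j\<in>?B. \<Sum>l\<in>?B. near j l) * (e * sqrt e)
       + x * ((\<Sum>j\<in>?B. \<Sum>l\<in>?B. near j l) * e)" for x
      by (simp add: sum.distrib distrib_right distrib_left sum_distrib_right sum_distrib_left
         power2_eq_square mult.assoc)
    show ?thesis unfolding 1
      by (simp add: sum.distrib distrib_left flip: sum_distrib_right sum_distrib_left mult.assoc)
        (simp add: algebra_simps power2_eq_square power4_eq_xxxx)
  qed
  also have "\<dots> \<le> real m ^ 4 * (2 * D + e\<^sup>2)
      + (real m)\<^sup>2 * (2 * real g * real m + 2 * real g * real m) * (e * sqrt e)
      + (2 * real g * real m) * (2 * real g * real m) * e"
  proof -
    have NA: "0 \<le> ?NA" "?NA \<le> 2 * real g * real m"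
      using card_close_pairs[where s=0 and m=m and g=g] by (simp_all add: near_def sum_nonneg)
    have NB: "0 \<le> ?NB" "?NB \<le> 2 * real g * real m"
      using card_close_pairs[where s="2*m" and m=m and g=g] by (simp_all add: near_def sum_nonneg)
    have "(real m)\<^sup>2 * (?NA + ?NB) * (e * sqrt e)
        \<le> (real m)\<^sup>2 * (2 * real g * real m + 2 * real g * real m) * (e * sqrt e)"
      by (intro mult_right_mono mult_left_mono add_mono NA NB) (use E in auto)
    moreover have "?NA * ?NB * e \<le> (2 * real g * real m) * (2 * real g * real m) * e"
      by (intro mult_right_mono mult_mono NA NB E) auto
    ultimately show ?thesis by linarith
  qed
  finally show ?thesis
    by (simp add: algebra_simps power2_eq_square power3_eq_cube power4_eq_xxxx)
qed

text \<open>Chebyshev's inequality is centred at \<open>m^2 * e\<close> instead of the exact mean,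
  so a lower bound for the mean and an upper bound for the second moment suffice. The leading terms
  \<open>m^4 * e^2\<close> cancel.\<close>

lemma prob_no_coincidence_le:
  assumes g: "0 < g" "g \<le> m" and Z_ne: "Z \<noteq> {}" and pos: "energy Z I > 0"
  defines "D \<equiv> C * exp (- \<theta> * real g)" and "e \<equiv> energy Z I"
  shows "prob {x \<in> space M. coincidences Z I m x = 0}
    \<le> 5 * (real (card Z))\<^sup>2 * D / e\<^sup>2 + 4 * (real g / (real m * sqrt e)) + 4 * (real g / (real m * sqrt e))\<^sup>2"
proof -
  let ?S = "coincidences Z I m" and ?E = "(real m)\<^sup>2 * e" and ?c = "real (card Z)"
  have D: "0 \<le> D" by (simp add: D_def const_nonneg)
  have e: "0 < e" "e \<le> 1"
    using pos energy_le_1 by (auto simp: e_def)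
  have m: "0 < real m" using g by simp
  have c: "1 \<le> ?c" using Z_ne Z_finite by (simp add: Suc_le_eq card_gt_0_iff)
  have S_meas [measurable]: "?S \<in> borel_measurable M" by (rule coincidences_measurable)
  have S_le: "norm (?S x) \<le> real (card ({0..<m} \<times> {2*m..<3*m} \<times> Z))" for x
    unfolding coincidences_def case_prod_beta
    by (rule order.trans[OF sum_norm_le[where g="\<lambda>_. 1"]])
      (auto simp: abs_mult visit_nonneg intro!: mult_le_one visit_le_1)
  have iS: "integrable M ?S"
    using S_le by (intro integrable_const_bound[OF _ S_meas]) auto
  have iS2: "integrable M (\<lambda>x. (?S x)\<^sup>2)"
  proof (rule integrable_const_bound)
    show "AE x in M. norm ((?S x)\<^sup>2) \<le> (real (card ({0..<m} \<times> {2*m..<3*m} \<times> Z)))\<^sup>2"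
      unfolding norm_power by (intro AE_I2 power_mono S_le norm_ge_zero)
  qed simp
  have iI: "integrable M (indicat_real {x \<in> space M. ?S x = 0})"
    by (intro integrable_unit) (auto simp: indicator_def)
  have "?E\<^sup>2 * prob {x \<in> space M. ?S x = 0} = expectation (\<lambda>x. ?E\<^sup>2 * indicator {x \<in> space M. ?S x = 0} x)"
    by simp
  also have "\<dots> \<le> expectation (\<lambda>x. (?S x)\<^sup>2 - 2 * ?E * ?S x + ?E\<^sup>2)"
  proof (rule integral_mono)
    fix x
    have "0 \<le> (?S x - ?E)\<^sup>2" by simp
    then show "?E\<^sup>2 * indicator {x \<in> space M. ?S x = 0} x \<le> (?S x)\<^sup>2 - 2 * ?E * ?S x + ?E\<^sup>2"
      by (auto simp: indicator_def power2_diff mult_ac)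
  qed (use iS iS2 iI in auto)
  also have "\<dots> = expectation (\<lambda>x. (?S x)\<^sup>2) - 2 * ?E * expectation ?S + ?E\<^sup>2"
    using iS iS2 by (simp add: prob_space)
  also have "\<dots> \<le> (real m ^ 4 * (e\<^sup>2 + 2 * D + ?c\<^sup>2 * D)
      + 4 * real g * real m ^ 3 * (e * sqrt e) + 4 * (real g)\<^sup>2 * (real m)\<^sup>2 * e)
      - 2 * ?E * ((real m)\<^sup>2 * (e - ?c * D)) + ?E\<^sup>2"
    using coincidences_expectation_ge[OF g] coincidences_second_moment_le[OF g] e
    by (intro add_mono diff_mono mult_left_mono) (auto simp: D_def e_def)
  also have "\<dots> = real m ^ 4 * (2 * D + ?c\<^sup>2 * D + 2 * e * ?c * D)
      + 4 * real g * real m ^ 3 * (e * sqrt e) + 4 * (real g)\<^sup>2 * (real m)\<^sup>2 * e"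
    by (simp add: algebra_simps power2_eq_square power4_eq_xxxx)
  also have "\<dots> \<le> real m ^ 4 * (5 * ?c\<^sup>2 * D)
      + 4 * real g * real m ^ 3 * (e * sqrt e) + 4 * (real g)\<^sup>2 * (real m)\<^sup>2 * e"
  proof -
    \<comment> \<open>The constant is \<open>5 = 2 + 1 + 2\<close>: since \<open>?c \<ge> 1\<close>
      and \<open>e \<le> 1\<close>, each of the three errors is a multiple of
      \<open>?c^2 * D\<close>.\<close>
    have "1 \<le> ?c\<^sup>2" "?c \<le> ?c\<^sup>2" using c by (simp_all add: self_le_power)
    moreover have "e * ?c \<le> 1 * ?c" using e c by (intro mult_right_mono) auto
    ultimately have "(2 + ?c\<^sup>2 + 2 * (e * ?c)) * D \<le> (5 * ?c\<^sup>2) * D"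
      by (intro mult_right_mono D) linarith
    then have "2 * D + ?c\<^sup>2 * D + 2 * e * ?c * D \<le> 5 * ?c\<^sup>2 * D"
      by (simp add: algebra_simps)
    then show ?thesis by (intro add_right_mono mult_left_mono) auto
  qed
  finally have "prob {x \<in> space M. ?S x = 0} \<le> (real m ^ 4 * (5 * ?c\<^sup>2 * D)
      + 4 * real g * real m ^ 3 * (e * sqrt e) + 4 * (real g)\<^sup>2 * (real m)\<^sup>2 * e) / ?E\<^sup>2"
    using e m by (simp add: pos_le_divide_eq mult.commute)
  also have "\<dots> = 5 * ?c\<^sup>2 * D / e\<^sup>2 + 4 * (real g / (real m * sqrt e)) + 4 * (real g / (real m * sqrt e))\<^sup>2"
  proof -
    have s: "e = sqrt e * sqrt e" "sqrt e > 0" using e by auto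
    define t where "t = sqrt e"
    have t: "e = t * t" "t > 0" "sqrt e = t" using s by (auto simp: t_def)
    show ?thesis unfolding t(3) unfolding t(1) using m t(2)
      by (simp add: field_simps power2_eq_square power3_eq_cube power4_eq_xxxx)
  qed
  finally show ?thesis .
qed

end

end

section \<open>A convergent logarithmic series\<close>

lemma summable_inverse_mult_ln_powr:
  fixes s :: real
  assumes "s > 1"
  shows "summable (\<lambda>n. 1 / (real (n + 1) * ln (real (n + 1)) powr s))"
proof -
  define f where "f n = 1 / (real (n + 1) * ln (real (n + 1)) powr s)" for n
  \<comment> \<open>Cauchy condensation: the logarithm of \<open>2 ^ n + 1\<close> is of order
    \<open>n\<close>, so the condensed terms are of order \<open>n powr - s\<close>.\<close>
  have "summable (\<lambda>n. 2 ^ n * f (2 ^ n))"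
  proof (rule summable_comparison_test_bigo)
    show "summable (\<lambda>n. norm (real n powr - s))"
      using assms by (simp add: summable_real_powr_iff)
    show "(\<lambda>n. 2 ^ n * f (2 ^ n)) \<in> O(\<lambda>n. real n powr - s)"
      unfolding f_def using assms by real_asymp
  qed
  \<comment> \<open>At 0 the logarithm vanishes and division by zero gives \<open>f 0 = 0\<close>,
    so \<open>f\<close> decreases only from index 1 on.\<close>
  moreover have "f n \<le> f m" if "0 < m" "m \<le> n" for m n
    unfolding f_def using that assms
    by (intro divide_left_mono mult_mono powr_mono2 mult_pos_pos) auto
  moreover have "f n \<ge> 0" for n
    by (simp add: f_def)
  ultimately have "summable f"
    using condensation_test[of f] by simp
  then show ?thesis by (simp only: f_def[abs_def])
qed

section \<open>Grid intervals and the energy of a ball integral\<close>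

definition grid :: "real \<Rightarrow> int \<Rightarrow> real set"
  where "grid r z = {of_int z * r ..< of_int (z + 1) * r}"

lemma is_interval_grid: "is_interval (grid r z)"
  by (simp add: grid_def is_interval_co)

lemma grid_iff: "r > 0 \<Longrightarrow> y \<in> grid r z \<longleftrightarrow> z = \<lfloor>y / r\<rfloor>"
  unfolding grid_def eq_commute[of z] floor_eq_iff by (auto simp: field_simps)

lemma disjoint_grid: "r > 0 \<Longrightarrow> disjoint_family_on (grid r) Z"
  by (auto simp: disjoint_family_on_def grid_iff)

lemma grid_dist_less: "x \<in> grid r z \<Longrightarrow> y \<in> grid r z \<Longrightarrow> \<bar>x - y\<bar> < r"
  by (auto simp: grid_def algebra_simps)

lemma ball_subset_grid:
  assumes "y \<in> grid r z"
  shows "ball y r \<subseteq> grid r (z - 1) \<union> grid r z \<union> grid r (z + 1)"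
  using assms by (auto simp: grid_def dist_real_def algebra_simps abs_less_iff)

context interval_mixing_system
begin

lemma mass_grid_sum_le_1:
  "r > 0 \<Longrightarrow> finite Z \<Longrightarrow> (\<Sum>z\<in>Z. mass (grid r z)) \<le> 1"
  by (rule sum_mass_le_1) (auto simp: is_interval_grid disjoint_grid)

lemma mass_ball_le:
  assumes "y \<in> grid r z"
  shows "mass (ball y r) \<le> mass (grid r (z - 1)) + mass (grid r z) + mass (grid r (z + 1))"
proof -
  have "mass (ball y r) \<le> prob ((grid r (z - 1) \<inter> space M) \<union> (grid r z \<inter> space M) \<union> (grid r (z + 1) \<inter> space M))"
    unfolding mass_def using ball_subset_grid[OF assms]
    by (intro finite_measure_mono sets.Un interval_sets is_interval_grid) auto
  also have "\<dots> \<le> prob ((grid r (z - 1) \<inter> space M) \<union> (grid r z \<inter> space M)) + mass (grid r (z + 1))"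
    unfolding mass_def
    by (intro measure_Un_le sets.Un interval_sets is_interval_grid)
  also have "prob ((grid r (z - 1) \<inter> space M) \<union> (grid r z \<inter> space M)) \<le> mass (grid r (z - 1)) + mass (grid r z)"
    unfolding mass_def
    by (intro measure_Un_le sets.Un interval_sets is_interval_grid)
  finally show ?thesis by simp
qed

text \<open>Symmetric windows of cells increase to the whole space, so continuity from below yields
  a finite window with almost full mass.\<close>

lemma ex_grid_window:
  assumes r: "r > 0" and \<delta>: "\<delta> > 0"
  obtains n :: int where "n \<ge> 0" "(\<Sum>z\<in>{-n..n}. mass (grid r z)) \<ge> 1 - \<delta>"
proof -
  define U where "U n = (\<Union>z\<in>{-int n..int n}. grid r z \<inter> space M)" for n
  have U_sum: "prob (U n) = (\<Sum>z\<in>{-int n..int n}. mass (grid r z))" for n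
    unfolding U_def mass_def
  proof (rule finite_measure_finite_Union)
    show "disjoint_family_on (\<lambda>z. grid r z \<inter> space M) {-int n..int n}"
      using disjoint_grid[OF r, of UNIV] unfolding disjoint_family_on_def by blast
  qed (auto intro!: interval_sets is_interval_grid)
  have "(\<lambda>n. prob (U n)) \<longlonglongrightarrow> prob (\<Union>n. U n)"
  proof (rule finite_Lim_measure_incseq)
    show "range U \<subseteq> events"
      unfolding U_def
      by (intro image_subsetI sets.finite_UN finite_atLeastAtMost_int interval_sets is_interval_grid)
    show "incseq U"
      unfolding U_def by (intro incseq_SucI UN_mono) auto
  qed
  also have "(\<Union>n. U n) = space M"
  proof (intro equalityI subsetI)
    fix y assume "y \<in> space M"
    then have "y \<in> U (nat \<bar>\<lfloor>y / r\<rfloor>\<bar>)"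
      unfolding U_def using r by (auto simp: grid_iff)
    then show "y \<in> (\<Union>n. U n)" by blast
  qed (auto simp: U_def)
  finally have "(\<lambda>n. prob (U n)) \<longlonglongrightarrow> 1" by (simp add: prob_space)
  then have "\<forall>\<^sub>F n in sequentially. prob (U n) > 1 - \<delta>"
    using \<delta> by (intro order_tendstoD) auto
  then obtain n where "prob (U n) > 1 - \<delta>"
    by (auto simp: eventually_sequentially)
  then show ?thesis using that[of "int n"] by (simp add: U_sum)
qed

text \<open>
  The space may be unbounded, so intervals of mass below \<open>q / 12\<close> are discarded: they carry little of
  the sum of squares, and at most \<open>12 / q\<close> intervals remain.
\<close>

lemma ex_grid_energy:
  assumes r: "r > 0"
  defines "q \<equiv> expectation (\<lambda>y. mass (ball y r))"
  assumes q: "q > 0"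
  obtains Z where "finite Z" "Z \<noteq> {}" "energy Z (grid r) \<ge> q / 12" "real (card Z) \<le> 12 / q"
proof -
  define a where "a z = mass (grid r z)" for z
  have a0: "a z \<ge> 0" for z by (simp add: a_def mass_nonneg)
  \<comment> \<open>The window misses at most \<open>q / 2\<close> of the mass, which leaves half of
    \<open>q\<close> to be accounted for inside it.\<close>
  obtain n where n: "n \<ge> 0" "(\<Sum>z\<in>{-n..n}. a z) \<ge> 1 - q / 2"
    using ex_grid_window[OF r, of "q / 2"] q unfolding a_def by (metis half_gt_zero)
  let ?W = "{-n..n}" and ?W' = "{-n-1..n+1}"
  define b where "b z = a (z - 1) + a z + a (z + 1)" for z
  have v: "visit 0 (grid r z) y = (if z = \<lfloor>y / r\<rfloor> then 1 else 0)" for z y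
    using r by (simp add: visit_def indicator_def grid_iff)
  have int: "integrable M (\<lambda>y. 1 - (\<Sum>z\<in>?W. visit 0 (grid r z) y) + (\<Sum>z\<in>?W. visit 0 (grid r z) y * b z))"
    by (intro Bochner_Integration.integrable_add Bochner_Integration.integrable_diff
        Bochner_Integration.integrable_sum integrable_mult_left visit_integrable is_interval_grid
        integrable_const)
  \<comment> \<open>The integrand is \<open>b\<close> at the cell of \<open>y\<close> inside the
    window and the trivial bound 1 outside. Only this upper bound is checked for integrability; its
    nonnegativity covers a left side whose integral would be 0 by convention.\<close>
  have "q \<le> expectation (\<lambda>y. 1 - (\<Sum>z\<in>?W. visit 0 (grid r z) y) + (\<Sum>z\<in>?W. visit 0 (grid r z) y * b z))"
    unfolding q_def
  proof (rule integral_mono'[OF int])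
    fix y
    have *: "1 - (\<Sum>z\<in>?W. visit 0 (grid r z) y) + (\<Sum>z\<in>?W. visit 0 (grid r z) y * b z)
      = (if \<lfloor>y / r\<rfloor> \<in> ?W then b \<lfloor>y / r\<rfloor> else 1)"
      by (simp add: v if_distrib[of "\<lambda>x. x * _"] sum.delta' cong: if_cong)
    have "mass (ball y r) \<le> b \<lfloor>y / r\<rfloor>"
      using mass_ball_le[of y r "\<lfloor>y / r\<rfloor>"] r by (simp add: grid_iff a_def b_def)
    moreover have "mass (ball y r) \<le> 1" by (simp add: mass_def)
    ultimately show le: "mass (ball y r)
        \<le> 1 - (\<Sum>z\<in>?W. visit 0 (grid r z) y) + (\<Sum>z\<in>?W. visit 0 (grid r z) y * b z)"
      unfolding * by simp
    show "0 \<le> 1 - (\<Sum>z\<in>?W. visit 0 (grid r z) y) + (\<Sum>z\<in>?W. visit 0 (grid r z) y * b z)"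
      by (rule order.trans[OF mass_nonneg le])
  qed
  also have "\<dots> = 1 - (\<Sum>z\<in>?W. a z) + (\<Sum>z\<in>?W. a z * b z)"
    by (simp add: visit_integrable is_interval_grid expectation_visit prob_space a_def
        Bochner_Integration.integral_sum)
  finally have "q / 2 \<le> (\<Sum>z\<in>?W. a z * b z)" using n by simp
  \<comment> \<open>Each neighbour product is at most half the sum of the two squares. After
    shifting into the wider window \<open>?W'\<close> the coefficients add up to
    \<open>2 + 1/2 + 1/2 = 3\<close>.\<close>
  also have "\<dots> \<le> (\<Sum>z\<in>?W. 2 * (a z)\<^sup>2 + (a (z - 1))\<^sup>2 / 2 + (a (z + 1))\<^sup>2 / 2)"
  proof (rule sum_mono)
    fix z
    show "a z * b z \<le> 2 * (a z)\<^sup>2 + (a (z - 1))\<^sup>2 / 2 + (a (z + 1))\<^sup>2 / 2"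
      using sum_squares_bound[of "a z" "a (z - 1)"] sum_squares_bound[of "a z" "a (z + 1)"]
      by (simp add: b_def algebra_simps power2_eq_square)
  qed
  also have "\<dots> = 2 * (\<Sum>z\<in>?W. (a z)\<^sup>2) + (\<Sum>z\<in>?W. (a (z - 1))\<^sup>2) / 2 + (\<Sum>z\<in>?W. (a (z + 1))\<^sup>2) / 2"
    by (simp add: sum.distrib sum_distrib_left sum_divide_distrib)
  also have "\<dots> \<le> 3 * (\<Sum>z\<in>?W'. (a z)\<^sup>2)"
  proof -
    have "(\<Sum>z\<in>?W. (a (z + d))\<^sup>2) \<le> (\<Sum>z\<in>?W'. (a z)\<^sup>2)" if "\<bar>d\<bar> \<le> 1" for d
    proof -
      have "(\<Sum>z\<in>?W. (a (z + d))\<^sup>2) = (\<Sum>z\<in>(\<lambda>z. z + d) ` ?W. (a z)\<^sup>2)"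
        by (subst sum.reindex) (auto simp: inj_on_def)
      also have "\<dots> \<le> (\<Sum>z\<in>?W'. (a z)\<^sup>2)"
        using that by (intro sum_mono2) auto
      finally show ?thesis .
    qed
    from this[of 0] this[of "-1"] this[of 1] show ?thesis by simp
  qed
  finally have e: "q / 6 \<le> (\<Sum>z\<in>?W'. (a z)\<^sup>2)" by simp
  \<comment> \<open>The threshold is half of the bound \<open>q / 6\<close>: the light cells
    contribute at most \<open>q / 12\<close>, and at least \<open>q / 12\<close> remains.\<close>
  define Z where "Z = {z \<in> ?W'. a z \<ge> q / 12}"
  have fin: "finite Z" unfolding Z_def by (rule finite_Collect_conjI) simp
  have "(\<Sum>z\<in>?W'. (a z)\<^sup>2) = (\<Sum>z\<in>Z. (a z)\<^sup>2) + (\<Sum>z\<in>?W' - Z. (a z)\<^sup>2)"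
    by (subst sum.subset_diff[of Z]) (auto simp: Z_def)
  also have "(\<Sum>z\<in>?W' - Z. (a z)\<^sup>2) \<le> (\<Sum>z\<in>?W' - Z. a z * (q / 12))"
    unfolding power2_eq_square by (intro sum_mono mult_left_mono a0) (auto simp: Z_def)
  also have "\<dots> = (\<Sum>z\<in>?W' - Z. a z) * (q / 12)"
    by (simp add: sum_distrib_right)
  also have "\<dots> \<le> 1 * (q / 12)"
    using q mass_grid_sum_le_1[OF r, of "?W' - Z"] by (intro mult_right_mono) (auto simp: a_def)
  finally have energy: "q / 12 \<le> energy Z (grid r)"
    using e by (simp add: energy_def a_def)
  then have "Z \<noteq> {}" using q by (auto simp: energy_def)
  moreover have "real (card Z) * (q / 12) \<le> (\<Sum>z\<in>Z. a z)"
    by (rule sum_bounded_below) (simp add: Z_def)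
  with mass_grid_sum_le_1[OF r fin] q have "real (card Z) \<le> 12 / q"
    by (simp add: a_def field_simps)
  ultimately show ?thesis using that fin energy by blast
qed

lemma closeF_sets: "closeF (space M) T n \<rho> \<in> sets M"
proof -
  have id: "(\<lambda>x. x) \<in> borel_measurable M"
    using measurable_restrict_space1[OF measurable_ident, of borel "space M"]
    by (subst measurable_cong_sets[OF borel_sets refl]) (simp add: id_def)
  have [measurable]: "(T ^^ i) \<in> borel_measurable M" for i
    using measurable_compose[OF funpow_measurable id] by simp
  have "closeF (space M) T n \<rho> = (\<Union>j\<in>{..<n}. \<Union>i\<in>{..<j}. {x \<in> space M. \<bar>(T ^^ i) x - (T ^^ j) x\<bar> < \<rho>})"
    by (auto simp: closeF_def)
  also have "\<dots> \<in> sets M" by measurable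
  finally show ?thesis .
qed

text \<open>Two visits to one cell are less than \<open>r\<close>, hence less than
  \<open>4 * r\<close>, apart. So a point outside the close set has no coincidence, and the energy
  and cardinality bounds for the chosen cells turn the estimate into one in
  \<open>q\<close>.\<close>

lemma prob_not_close_le:
  assumes r: "r > 0" and g: "0 < g" "g \<le> m"
  defines "q \<equiv> expectation (\<lambda>y. mass (ball y r))"
  assumes q: "q > 0"
  defines "u \<equiv> real g / (real m * sqrt (q / 12))"
  shows "prob (space M - closeF (space M) T (3 * m) (4 * r))
    \<le> 103680 * (C * exp (- \<theta> * real g)) / q ^ 4 + 4 * u + 4 * u\<^sup>2"
proof -
  define D where "D = C * exp (- \<theta> * real g)"
  have D: "D \<ge> 0" by (simp add: D_def const_nonneg)
  obtain Z where Z: "finite Z" "Z \<noteq> {}" "energy Z (grid r) \<ge> q / 12" "real (card Z) \<le> 12 / q"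
    using ex_grid_energy[OF r] q unfolding q_def by metis
  define e where "e = energy Z (grid r)"
  have e: "q / 12 \<le> e" "e > 0" using Z q by (auto simp: e_def)
  define w where "w = real g / (real m * sqrt e)"
  have m: "real m > 0" using g by simp
  have w: "0 \<le> w" "w \<le> u"
    unfolding w_def u_def using e q m by (auto intro!: divide_left_mono mult_left_mono mult_pos_pos)
  have "prob (space M - closeF (space M) T (3 * m) (4 * r)) \<le> prob {x \<in> space M. coincidences Z (grid r) m x = 0}"
  proof (rule finite_measure_mono)
    show "space M - closeF (space M) T (3 * m) (4 * r) \<subseteq> {x \<in> space M. coincidences Z (grid r) m x = 0}"
    proof safe
      fix x assume x: "x \<in> space M" "x \<notin> closeF (space M) T (3 * m) (4 * r)"
      have "visit i (grid r a) x * visit j (grid r a) x = 0" if "i < m" "2 * m \<le> j" "j < 3 * m" for i j a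
      proof (rule ccontr)
        assume "visit i (grid r a) x * visit j (grid r a) x \<noteq> 0"
        then have "(T ^^ i) x \<in> grid r a" "(T ^^ j) x \<in> grid r a"
          by (auto simp: visit_def indicator_def split: if_splits)
        then have "\<bar>(T ^^ i) x - (T ^^ j) x\<bar> < 4 * r"
          using grid_dist_less r by fastforce
        then show False using x that by (auto simp: closeF_def)
      qed
      then show "coincidences Z (grid r) m x = 0"
        unfolding coincidences_def by (intro sum.neutral) auto
    qed
    have [measurable]: "coincidences Z (grid r) m \<in> borel_measurable M"
      using Z(1) is_interval_grid disjoint_grid[OF r] by (intro coincidences_measurable)
    show "{x \<in> space M. coincidences Z (grid r) m x = 0} \<in> sets M"
      by measurable
  qed
  also have "\<dots> \<le> 5 * (real (card Z))\<^sup>2 * D / e\<^sup>2 + 4 * w + 4 * w\<^sup>2"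
    unfolding D_def e_def w_def
    by (rule prob_no_coincidence_le[OF Z(1) is_interval_grid disjoint_grid[OF r] g Z(2) e(2)[unfolded e_def]])
  also have "\<dots> \<le> 5 * (12 / q)\<^sup>2 * D / (q / 12)\<^sup>2 + 4 * u + 4 * u\<^sup>2"
  proof -
    have "(real (card Z))\<^sup>2 \<le> (12 / q)\<^sup>2" "(q / 12)\<^sup>2 \<le> e\<^sup>2" "w\<^sup>2 \<le> u\<^sup>2"
      using w Z e q by (auto intro: power_mono)
    moreover from this have "5 * (real (card Z))\<^sup>2 * D / e\<^sup>2 \<le> 5 * (12 / q)\<^sup>2 * D / (q / 12)\<^sup>2"
      using q D by (intro frac_le mult_right_mono mult_left_mono) auto
    ultimately show ?thesis using w by linarith
  qed
  \<comment> \<open>The constant is \<open>5 * 12^2 * 12^2\<close>.\<close>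
  also have "5 * (12 / q)\<^sup>2 * D / (q / 12)\<^sup>2 = 103680 * D / q ^ 4"
    using q by (simp add: field_simps power2_eq_square power4_eq_xxxx)
  finally show ?thesis unfolding D_def .
qed

end

section \<open>Dyadic scales and Borel-Cantelli\<close>

lemma summable_log_scale:
  fixes \<epsilon> :: real
  assumes "\<epsilon> > 0"
  shows "summable (\<lambda>k. 1 / (ln (6 * 2 ^ k) * ln (ln (6 * 2 ^ k)) powr (1 + \<epsilon> / 2)))"
proof (rule summable_comparison_test_bigo)
  show "summable (\<lambda>k. norm (1 / (real (k + 1) * ln (real (k + 1)) powr (1 + \<epsilon> / 2))))"
    using summable_inverse_mult_ln_powr[of "1 + \<epsilon> / 2"] assms by (simp add: abs_mult)
  \<comment> \<open>Since \<open>ln (6 * 2 ^ k) = k * ln 2 + ln 6\<close>, the terms of the two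
    series have the same order.\<close>
  show "(\<lambda>k. 1 / (ln (6 * 2 ^ k) * ln (ln (6 * 2 ^ k)) powr (1 + \<epsilon> / 2)))
      \<in> O(\<lambda>k. 1 / (real (k + 1) * ln (real (k + 1)) powr (1 + \<epsilon> / 2)))"
    using assms by real_asymp
qed

context interval_mixing_system
begin

text \<open>The scale \<open>k\<close> serves all \<open>n\<close> between \<open>3 * 2 ^ k\<close>
  and \<open>6 * 2 ^ k\<close>, so the bound on \<open>q\<close> is taken at the upper end. With
  \<open>g\<close> of order \<open>L\<close>, the quotient \<open>u\<close> has order at most
  \<open>L / (L^2 * ln L powr (1 + \<epsilon> / 2))\<close>, which is \<open>h\<close>; the mixing
  error decays geometrically.\<close>

lemma prob_not_close_dyadic_le:
  fixes k :: nat and \<rho> \<epsilon> :: real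
  defines "L \<equiv> ln (6 * 2 ^ k)" and "q \<equiv> expectation (\<lambda>y. mass (ball y \<rho>))"
  defines "h \<equiv> 1 / (L * ln L powr (1 + \<epsilon> / 2))" and "K \<equiv> 10 * sqrt 432 / \<theta>"
  assumes \<rho>: "\<rho> > 0" and \<epsilon>: "\<epsilon> > 0"
    and q: "q \<ge> L ^ 4 * ln L powr (2 + \<epsilon>) / (6 * 2 ^ k)\<^sup>2"
    and L: "L \<ge> exp 1" "L \<ge> \<theta>" "10 * L / \<theta> \<le> 2 ^ k"
  shows "prob (space M - closeF (space M) T (3 * 2 ^ k) (4 * \<rho>))
    \<le> 17280 * C * (1 / 2) ^ k + (4 * K + 4 * K\<^sup>2) * h"
proof -
  define m :: nat where "m = 2 ^ k"
  have m: "real m = 2 ^ k" "real m \<ge> 1" by (simp_all add: m_def)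
  \<comment> \<open>The factor 9 makes \<open>exp (- \<theta> g)\<close> beat \<open>q\<^sup>-\<^sup>4 = O(m\<^sup>8)\<close> by one power of \<open>m\<close>.\<close>
  define g where "g = nat \<lceil>9 * L / \<theta>\<rceil>"
  have "exp (1 :: real) \<ge> 1" by simp
  with L have L1: "L \<ge> 1" by linarith
  have lnL: "ln L \<ge> 1" using L L1 by (simp add: ln_ge_iff)
  have pos: "9 * L / \<theta> > 0" using L1 rate_pos by simp
  have g_lower: "9 * L / \<theta> \<le> real g"
    unfolding g_def by (rule real_nat_ceiling_ge)
  \<comment> \<open>The 1 lost in rounding up is absorbed into a tenth \<open>L / \<theta>\<close>,
    using \<open>L \<ge> \<theta>\<close>.\<close>
  have "real g \<le> 9 * L / \<theta> + 1"
    unfolding g_def using pos by (simp add: of_nat_nat)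
  also have "\<dots> \<le> 10 * L / \<theta>" using L(2) rate_pos by (simp add: field_simps)
  finally have g_upper: "real g \<le> 10 * L / \<theta>" .
  have g: "0 < g" "g \<le> m"
    using g_lower pos g_upper L(3) m by linarith+
  have D: "C * exp (- \<theta> * real g) \<le> C / (6 * real m) ^ 9"
  proof -
    have "- \<theta> * real g \<le> - (9 * L)" using g_lower rate_pos by (simp add: field_simps)
    then have "exp (- \<theta> * real g) \<le> exp (- (9 * L))" by simp
    also have "\<dots> = 1 / exp L ^ 9" by (simp add: exp_minus field_simps flip: exp_of_nat_mult)
    also have "exp L = 6 * real m" by (simp add: L_def m)
    finally have "exp (- \<theta> * real g) \<le> 1 / (6 * real m) ^ 9" .
    from mult_left_mono[OF this const_nonneg] show ?thesis by simp
  qed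
  define Q where "Q = L ^ 4 * ln L powr (2 + \<epsilon>)"
  have Q1: "Q \<ge> 1"
  proof -
    have "1 * 1 \<le> L ^ 4 * ln L powr (2 + \<epsilon>)"
      using L1 lnL \<epsilon> by (intro mult_mono ge_one_powr_ge_zero one_le_power) auto
    then show ?thesis by (simp add: Q_def)
  qed
  have qQ: "q \<ge> Q / (36 * (real m)\<^sup>2)"
    using q by (simp add: Q_def m power_mult_distrib)
  have q1: "q \<ge> 1 / (36 * (real m)\<^sup>2)"
    by (rule order.trans[OF divide_right_mono qQ]) (use Q1 in auto)
  then have q0: "q > 0" using m by (smt (verit) divide_pos_pos zero_less_power)
  have "C * exp (- \<theta> * real g) / q ^ 4 \<le> (C / (6 * real m) ^ 9) / (1 / (36 * (real m)\<^sup>2)) ^ 4"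
    using D q1 q0 m const_nonneg by (intro frac_le power_mono) auto
  \<comment> \<open>As \<open>(36 * m^2)^4 = (6 * m)^8\<close>, one factor
    \<open>1 / (6 * m)\<close> is left, and \<open>17280 = 103680 / 6\<close>.\<close>
  also have "\<dots> = C / 6 * (1 / 2) ^ k"
    using m by (simp add: field_simps power_mult_distrib flip: m(1) power_mult power_add)
      (simp add: power_numeral_reduce)
  finally have first: "103680 * (C * exp (- \<theta> * real g)) / q ^ 4 \<le> 17280 * C * (1 / 2) ^ k"
    by simp
  define u where "u = real g / (real m * sqrt (q / 12))"
  have "u \<le> K * h"
  proof -
    \<comment> \<open>Here \<open>432 = 36 * 12\<close>, from \<open>(6 * m)^2\<close> and the
      energy bound \<open>q / 12\<close>.\<close>
    have "L\<^sup>2 * ln L powr (1 + \<epsilon> / 2) / sqrt 432 = sqrt (Q / 432)"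
    proof -
      have "sqrt Q = L\<^sup>2 * ln L powr (1 + \<epsilon> / 2)"
      proof (rule real_sqrt_unique)
        have "(ln L powr (1 + \<epsilon> / 2))\<^sup>2 = ln L powr (2 + \<epsilon>)"
          by (simp add: power2_eq_square flip: powr_add)
        then show "(L\<^sup>2 * ln L powr (1 + \<epsilon> / 2))\<^sup>2 = Q"
          by (simp add: Q_def power_mult_distrib flip: power_mult)
      qed simp
      then show ?thesis by (simp add: real_sqrt_divide)
    qed
    also have "\<dots> \<le> sqrt ((real m)\<^sup>2 * (q / 12))"
      using qQ m by (simp add: field_simps)
    also have "\<dots> = real m * sqrt (q / 12)"
      by (subst real_sqrt_mult) simp
    finally have den: "L\<^sup>2 * ln L powr (1 + \<epsilon> / 2) / sqrt 432 \<le> real m * sqrt (q / 12)" .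
    have "u \<le> (10 * L / \<theta>) / (L\<^sup>2 * ln L powr (1 + \<epsilon> / 2) / sqrt 432)"
      unfolding u_def using g_upper den L1 lnL rate_pos
      by (intro frac_le divide_pos_pos mult_pos_pos) auto
    also have "\<dots> = K * h"
      using L1 by (simp add: K_def h_def power2_eq_square)
    finally show ?thesis .
  qed
  moreover have u0: "0 \<le> u" using q0 by (simp add: u_def)
  moreover have h: "0 \<le> h" "h \<le> 1"
  proof -
    have "1 * 1 \<le> L * ln L powr (1 + \<epsilon> / 2)"
      using L1 lnL \<epsilon> by (intro mult_mono ge_one_powr_ge_zero) auto
    then show "0 \<le> h" "h \<le> 1" by (auto simp: h_def)
  qed
  ultimately have "u\<^sup>2 \<le> (K * h)\<^sup>2" by (intro power_mono)
  \<comment> \<open>Because \<open>h \<le> 1\<close>, the quadratic term is also bounded by a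
    multiple of the summable \<open>h\<close>.\<close>
  also have "\<dots> \<le> K\<^sup>2 * h"
    unfolding power_mult_distrib using h
    by (intro mult_left_mono) (auto simp: power2_eq_square mult_left_le)
  finally have "u\<^sup>2 \<le> K\<^sup>2 * h" .
  with first \<open>u \<le> K * h\<close> prob_not_close_le[OF \<rho> g q0[unfolded q_def]]
  show ?thesis
    unfolding u_def q_def m_def by (simp add: distrib_right)
qed

text \<open>The size conditions on \<open>L\<close> hold for all large \<open>k\<close>. The failure
  probabilities are then dominated by a geometric series plus a multiple of the logarithmic one, and
  Borel-Cantelli applies to the complements.\<close>

lemma AE_eventually_close_dyadic:
  fixes \<rho> :: "nat \<Rightarrow> real" and \<epsilon> :: real
  assumes \<rho>: "\<And>k. \<rho> k > 0" and \<epsilon>: "\<epsilon> > 0"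
    and q: "\<forall>\<^sub>F k in sequentially. expectation (\<lambda>y. mass (ball y (\<rho> k)))
      \<ge> ln (6 * 2 ^ k) ^ 4 * ln (ln (6 * 2 ^ k)) powr (2 + \<epsilon>) / (6 * 2 ^ k)\<^sup>2"
  shows "AE x in M. \<forall>\<^sub>F k in sequentially. x \<in> closeF (space M) T (3 * 2 ^ k) (4 * \<rho> k)"
proof -
  define K where "K = 10 * sqrt 432 / \<theta>"
  define A where "A k = space M - closeF (space M) T (3 * 2 ^ k) (4 * \<rho> k)" for k
  have "\<forall>\<^sub>F k :: nat in sequentially. ln (6 * 2 ^ k :: real) \<ge> exp 1"
    "\<forall>\<^sub>F k :: nat in sequentially. ln (6 * 2 ^ k) \<ge> \<theta>"
    "\<forall>\<^sub>F k :: nat in sequentially. 10 * ln (6 * 2 ^ k) / \<theta> \<le> 2 ^ k"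
    using rate_pos by real_asymp+
  with q have "\<forall>\<^sub>F k in sequentially. norm (prob (A k)) \<le> 17280 * C * (1 / 2) ^ k
      + (4 * K + 4 * K\<^sup>2) * (1 / (ln (6 * 2 ^ k) * ln (ln (6 * 2 ^ k)) powr (1 + \<epsilon> / 2)))"
  proof eventually_elim
    case (elim k)
    from prob_not_close_dyadic_le[OF \<rho> \<epsilon> elim] show ?case
      by (simp add: A_def K_def)
  qed
  moreover have "summable (\<lambda>k. 17280 * C * (1 / 2) ^ k
      + (4 * K + 4 * K\<^sup>2) * (1 / (ln (6 * 2 ^ k) * ln (ln (6 * 2 ^ k)) powr (1 + \<epsilon> / 2))))"
    by (intro summable_add summable_mult summable_log_scale \<epsilon> summable_geometric) simp
  ultimately have "summable (\<lambda>k. prob (A k))"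
    by (rule summable_comparison_test_ev)
  then have "AE x in M. \<forall>\<^sub>F k in sequentially. x \<in> space M - A k"
    by (intro borel_cantelli_AE1) (auto simp: A_def closeF_sets emeasure_eq_measure)
  then show ?thesis
    by (rule eventually_mono) (auto elim!: eventually_mono simp: A_def)
qed

end

section \<open>From dyadic scales to all \<open>n\<close>\<close>

lemma closeF_mono: "n \<le> n' \<Longrightarrow> \<rho> \<le> \<rho>' \<Longrightarrow> closeF X T n \<rho> \<subseteq> closeF X T n' \<rho>'"
  by (force simp: closeF_def)

text \<open>For \<open>n\<close> between \<open>3 * 2 ^ k\<close> and \<open>6 * 2 ^ k\<close>,
  passing from the dyadic set to the one at \<open>n\<close> admits more times and, as
  \<open>r\<close> decreases, a radius at least as large.\<close>

lemma eventually_close_of_dyadic: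
  fixes r :: "nat \<Rightarrow> real"
  assumes r: "decseq r"
    and ev: "\<forall>\<^sub>F k in sequentially. x \<in> closeF X T (3 * 2 ^ k) (4 * r (6 * 2 ^ k))"
  shows "x \<in> (\<Union>N. \<Inter>n\<in>{N..}. closeF X T n (4 * r n))"
proof -
  obtain k0 where k0: "\<And>k. k \<ge> k0 \<Longrightarrow> x \<in> closeF X T (3 * 2 ^ k) (4 * r (6 * 2 ^ k))"
    using ev by (auto simp: eventually_sequentially)
  have "x \<in> closeF X T n (4 * r n)" if n: "n \<ge> 3 * 2 ^ k0" for n
  proof -
    have n3: "2 ^ k0 \<le> n div 3" using n by simp
    then have "1 \<le> n div 3" by (meson one_le_numeral one_le_power order.trans)
    \<comment> \<open>Here \<open>k\<close> is the integer binary logarithm of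
      \<open>n div 3\<close>, which places \<open>n\<close> in the range of scale
      \<open>k\<close>.\<close>
    then obtain k where k: "2 ^ k \<le> n div 3" "n div 3 < 2 ^ (k + 1)"
      using ex_power_ivl1[of 2 "n div 3"] by auto
    have "(2::nat) ^ k0 < 2 ^ (k + 1)" using n3 k by simp
    then have "k0 \<le> k" using power_less_imp_less_exp[of "2::nat" k0 "k + 1"] by simp
    moreover have "3 * 2 ^ k \<le> n" "n \<le> 6 * 2 ^ k" using k by auto
    ultimately show ?thesis
      using k0[of k] closeF_mono[of "3 * 2 ^ k" n "4 * r (6 * 2 ^ k)" "4 * r n" X T] decseqD[OF r]
      by auto
  qed
  then show ?thesis by auto
qed

theorem mainTheorem14:
  fixes M :: "real measure" and T :: "real \<Rightarrow> real" and r :: "nat \<Rightarrow> real"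
  assumes interval: "is_interval (space M)"
    and borel_sets: "sets M = sets (restrict_space borel (space M))"
    and prob: "prob_space M"
    and preserving: "T \<in> M \<rightarrow>\<^sub>M M" and invariant: "distr M M T = M"
    and mixing: "exp_4mixing_BV_Linf_unif M T"
    and r_pos: "\<And>n. r n > 0"
    and r_decr: "\<And>n. r (Suc n) \<le> r n"
    and r_lower: "\<exists>\<beta>>0. \<forall>n\<ge>1. r n \<ge> real n powr (- \<beta>)"
    and r_int: "\<exists>\<epsilon>>0. \<forall>\<^sub>F n in sequentially.
        (\<integral>y. measure M (ball y (r n) \<inter> space M) \<partial>M)
          \<ge> (ln (real n)) ^ 4 * (ln (ln (real n))) powr (2 + \<epsilon>) / (real n)\<^sup>2"
  shows "measure M (\<Union>N. \<Inter>n\<in>{N..}. closeF (space M) T n (4 * r n)) = 1"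
proof -
  from mixing obtain \<theta> C0 where \<theta>: "\<theta> > 0" and C0: "\<forall>I1 I2 I3 I4 :: real set.
        is_interval I1 \<and> is_interval I2 \<and> is_interval I3 \<and> is_interval I4 \<longrightarrow>
        (\<forall>a b c. a < b \<and> b \<le> c \<longrightarrow>
           mix4_defect M T (indicator I1) (indicator I2) (indicator I3) (indicator I4) a b c
             \<le> C0 * exp (- \<theta> * real (b - a)))"
    unfolding exp_4mixing_BV_Linf_unif_def by (elim exE conjE) (rule that)
  interpret prob_space M by (rule prob)
  \<comment> \<open>The given \<open>C0\<close> may be negative; the maximum with 0 keeps the bound
    valid and meets \<open>const_nonneg\<close>.\<close>
  interpret interval_mixing_system M T \<theta> "max C0 0"
  proof unfold_locales
    fix I1 I2 I3 I4 :: "real set" and a b c :: nat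
    assume "is_interval I1" "is_interval I2" "is_interval I3" "is_interval I4" "a < b" "b \<le> c"
    then have "mix4_defect M T (indicator I1) (indicator I2) (indicator I3) (indicator I4) a b c
        \<le> C0 * exp (- \<theta> * real (b - a))"
      using C0 by simp
    also have "\<dots> \<le> max C0 0 * exp (- \<theta> * real (b - a))"
      by (intro mult_right_mono) auto
    finally show "mix4_defect M T (indicator I1) (indicator I2) (indicator I3) (indicator I4) a b c
        \<le> max C0 0 * exp (- \<theta> * real (b - a))" .
  qed (use borel_sets preserving invariant \<theta> in auto)
  obtain \<epsilon> where \<epsilon>: "\<epsilon> > 0" and ev: "\<forall>\<^sub>F n in sequentially. expectation (\<lambda>y. mass (ball y (r n)))
      \<ge> ln (real n) ^ 4 * ln (ln (real n)) powr (2 + \<epsilon>) / (real n)\<^sup>2"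
    using r_int unfolding mass_def by blast
  \<comment> \<open>The integral condition is read along the subsequence
    \<open>n = 6 * 2 ^ k\<close>.\<close>
  have "filterlim (\<lambda>k. 6 * 2 ^ k :: nat) sequentially sequentially"
    by (rule filterlim_subseq) (simp add: strict_mono_def)
  from eventually_compose_filterlim[OF ev this]
  have "\<forall>\<^sub>F k in sequentially. expectation (\<lambda>y. mass (ball y (r (6 * 2 ^ k))))
      \<ge> ln (6 * 2 ^ k) ^ 4 * ln (ln (6 * 2 ^ k)) powr (2 + \<epsilon>) / (6 * 2 ^ k)\<^sup>2"
    by simp
  then have "AE x in M. \<forall>\<^sub>F k in sequentially. x \<in> closeF (space M) T (3 * 2 ^ k) (4 * r (6 * 2 ^ k))"
    by (rule AE_eventually_close_dyadic[where \<rho> = "\<lambda>k. r (6 * 2 ^ k)", OF r_pos \<epsilon>])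
  then have "AE x in M. x \<in> (\<Union>N. \<Inter>n\<in>{N..}. closeF (space M) T n (4 * r n))"
    by (rule eventually_mono) (intro eventually_close_of_dyadic decseq_SucI r_decr)
  moreover have "(\<Union>N. \<Inter>n\<in>{N..}. closeF (space M) T n (4 * r n)) \<in> sets M"
    by (intro sets.countable_UN' sets.countable_INT' closeF_sets) (auto intro: closeF_sets)
  ultimately show ?thesis by (simp only: prob_eq_1)
qed

end
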